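(* Let $(\lambda_j)_{j\geq 0}$ be real numbers with $\lambda_{j+1}-\lambda_j>0$ for every $j\ge 0$, and let $(a_j)_{j\geq 0}$ be a sequence of complex numbers with finite support. Then $$\lim_{T\to+\infty}\frac1T\int_{-T/2}^{T/2}\left|\sum_{j=0}^{+\infty}a_je^{2i\pi\lambda_j t}\right|\,\mathrm{d}t\geq C_{MPS}\sum_{j=0}^{+\infty}\frac{|a_j|}{j+1},$$ where $C_{MPS}$ is the same constant as in the integer-frequency inequality of Mc Gehee, Pigno and Smith recalled in the context. Moreover, assume that $(\lambda_j)_{j\ge0}$ is $q$-lacunary for some $q>1$, i.e. $\lambda_0\geq 1$ and $\lambda_{j+1}\geq q\lambda_j$ for every $j\ge 0$. Then, for $1\leq p<+\infty$, $$A_{p,q}\left(\sum_{j=0}^{+\infty}|a_j|^2\right)^{1/2}\leq \lim_{T\to+\infty}\left(\frac1T\int_{-T/2}^{T/2}\left|\sum_{j=0}^{+\infty}a_je^{2i\pi\lambda_j t}\right|^p\,\mathrm{d}t\right)^{1/p}\leq B_{p,q}\left(\sum_{j=0}^{+\infty}|a_j|^2\right)^{1/2},$$ where $A_{p,q},B_{p,q}$ are the constants of the integer-frequency lacunary inequality recalled in the context.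
   Context: $C_{MPS}>0$ denotes a universal constant such that, for all integers $n_1<n_2<\cdots<n_N$ and all complex numbers $a_1,\ldots,a_N$, $$\int_{-1/2}^{1/2}\left|\sum_{k=1}^N a_ke^{2i\pi n_k t}\right|\,\mathrm{d}t\geq C_{MPS}\sum_{k=1}^N\frac{|a_k|}{k}.$$ Such a constant exists by the theorem of Mc Gehee, Pigno and Smith ($C_{MPS}=1/30$ would do). For $1\le p<+\infty$ and $q>1$, $A_{p,q}$ and $B_{p,q}$ denote positive constants, depending only on $p$ and $q$, such that for every sequence of integers $(n_j)_{j\ge0}$ with $n_0\ge1$ and $n_{j+1}\ge q n_j$ for all $j$, and every $(c_j)_{j\ge 0}\in\ell^2$, $$A_{p,q}\Bigl(\sum_{j\ge0}|c_j|^2\Bigr)^{1/2}\le\Bigl(\int_0^1\Bigl|\sum_{j\ge0}c_je^{2i\pi n_jt}\Bigr|^p\,\mathrm{d}t\Bigr)^{1/p}\le B_{p,q}\Bigl(\sum_{j\ge0}|c_j|^2\Bigr)^{1/2}.$$ Such constants exist (classical theorem on lacunary Fourier series), and they are chosen so that, for each $p$, the maps $q\mapsto A_{p,q}$ and $q\mapsto B_{p,q}$ are continuous on $(1,+\infty)$. *)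

theory Defs
  imports "HOL-Analysis.Analysis"
begin

definition MPS_constant :: "real \<Rightarrow> bool" where
  "MPS_constant C \<longleftrightarrow> 0 < C \<and>
     (\<forall>(N::nat) (n::nat \<Rightarrow> int) (a::nat \<Rightarrow> complex).
        strict_mono_on {1..N} n \<longrightarrow>
        (LBINT t:{-1/2..1/2}. norm (\<Sum>k=1..N. a k * cis (2 * pi * of_int (n k) * t)))
          \<ge> C * (\<Sum>k=1..N. norm (a k) / real k))"

definition lacunary :: "real \<Rightarrow> (nat \<Rightarrow> real) \<Rightarrow> bool" where
  "lacunary q x \<longleftrightarrow> 1 \<le> x 0 \<and> (\<forall>j. q * x j \<le> x (Suc j))"

text \<open>For square-summable coefficients the trigonometric series need not converge pointwise
  everywhere; its sum is understood in \<open>L\<^sup>2\<close> of the unit interval, so that \<open>F\<close> below ranges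
  over the representatives of the sum. The nonnegative integral takes the value \<open>\<infinity>\<close>
  outside \<open>L\<^sup>2\<close>, so no separate integrability condition is needed.\<close>

definition L2_trig_sum :: "(nat \<Rightarrow> int) \<Rightarrow> (nat \<Rightarrow> complex) \<Rightarrow> (real \<Rightarrow> complex) \<Rightarrow> bool" where
  "L2_trig_sum n c F \<longleftrightarrow> F \<in> borel_measurable lborel \<and>
     (\<lambda>N. \<integral>\<^sup>+t\<in>{0..1}. ennreal ((norm (F t - (\<Sum>j<N. c j * cis (2 * pi * of_int (n j) * t))))\<^sup>2) \<partial>lborel)
       \<longlonglongrightarrow> 0"

text \<open>Integrability of \<open>\<bar>F\<bar>\<^sup>p\<close> is part of the two-sided estimate (finiteness of the \<open>L\<^sup>p\<close> norm);
  it has to be explicit because the Bochner integral of a non-integrable function is \<open>0\<close>.\<close>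

definition lacunary_constants :: "(real \<Rightarrow> real \<Rightarrow> real) \<Rightarrow> (real \<Rightarrow> real \<Rightarrow> real) \<Rightarrow> bool" where
  "lacunary_constants A B \<longleftrightarrow>
     (\<forall>p\<ge>1. continuous_on {1<..} (A p) \<and> continuous_on {1<..} (B p) \<and>
       (\<forall>q>1. 0 < A p q \<and> 0 < B p q \<and>
         (\<forall>(n::nat \<Rightarrow> int) (c::nat \<Rightarrow> complex) F.
            lacunary q (\<lambda>j. of_int (n j)) \<longrightarrow> summable (\<lambda>j. (norm (c j))\<^sup>2) \<longrightarrow> L2_trig_sum n c F \<longrightarrow>
              set_integrable lborel {0..1} (\<lambda>t. norm (F t) powr p) \<and>
              A p q * sqrt (\<Sum>j. (norm (c j))\<^sup>2) \<le> (LBINT t:{0..1}. norm (F t) powr p) powr (1 / p) \<and>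
              (LBINT t:{0..1}. norm (F t) powr p) powr (1 / p) \<le> B p q * sqrt (\<Sum>j. (norm (c j))\<^sup>2))))"

end

theory Submission
  imports Defs
begin

text \<open>The idea is to replace the real frequencies by rational ones with a common denominator $m$ and to
  look at the trigonometric sum on one full period of length $m$. By Dirichlet's theorem on
  simultaneous approximation there are arbitrarily large $m$ and integers $n_j$ with
  $|m \lambda_j - n_j|$ as small as desired, simultaneously for the finitely many $j$ with
  $a_j \neq 0$. For $|t| \le m/2$ the phases $\lambda_j t$ and $n_j t / m$ then differ by at most
  $|m\lambda_j - n_j| / 2$, so the sum $f$ with frequencies $\lambda_j$ and the sum with frequencies
  $n_j / m$ are uniformly close on the whole interval $[-m/2, m/2]$. After rescaling by $m$,
  the mean of the second one is an integral over $[-1/2, 1/2]$ of a sum with integer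
  frequencies $n_j$, to which the integer inequalities apply. Hence any inequality for the integer
  integrals passes to the limit of the means along the chosen values of $m$
  (\<open>mean_as_limit_of_integer_frequencies\<close>).

  That the mean of $|f|^p$ has a limit along all $T \to \infty$ is a separate matter. The
  function $|f|^2$ is a trigonometric polynomial with values in a compact interval, and $|f|^p$ is a continuous
  function of it; by the Weierstrass theorem it is a uniform limit of polynomials in $|f|^2$,
  which are again trigonometric polynomials and visibly have a mean
  (\<open>mean_norm_trig_polynomial_converges\<close>).

  Since $n_j / m \to \lambda_j$, strict monotonicity of $\lambda$ is inherited by the $n_j$ once
  $m$ is large, which gives the first inequality. Lacunarity with ratio $q$ is inherited only with every
  ratio $r < q$, because $n_{j+1} / n_j$ merely tends to $\lambda_{j+1} / \lambda_j \ge q$; the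
  continuity of the constants in the ratio then allows $r$ to increase to $q$.\<close>

section \<open>Means over long symmetric intervals\<close>

definition mean :: "real \<Rightarrow> (real \<Rightarrow> 'a::{banach, second_countable_topology}) \<Rightarrow> 'a" where
  "mean T f = (1 / T) *\<^sub>R (LBINT t:{-T/2..T/2}. f t)"

lemma mean_diff_le:
  assumes T: "T > 0" and f: "continuous_on UNIV f" and g: "continuous_on UNIV g"
    and le: "\<And>t. t \<in> {-T/2..T/2} \<Longrightarrow> norm (f t - g t) \<le> e"
  shows "norm (mean T f - mean T g) \<le> e"
proof -
  have i: "set_integrable lborel {-T/2..T/2} h" if "continuous_on UNIV h" for h :: "real \<Rightarrow> 'a"
    using that by (intro borel_integrable_atLeastAtMost') (auto intro: continuous_on_subset)
  have c: "continuous_on UNIV (\<lambda>t. f t - g t)" "continuous_on UNIV (\<lambda>t. norm (f t - g t))"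
    using f g by (auto intro!: continuous_intros)
  have "mean T f - mean T g = (1 / T) *\<^sub>R (LBINT t:{-T/2..T/2}. f t - g t)"
    using i[OF f] i[OF g] by (simp add: mean_def set_integral_diff scaleR_diff_right)
  moreover have "norm (LBINT t:{-T/2..T/2}. f t - g t) \<le> (LBINT t:{-T/2..T/2}. norm (f t - g t))"
    using i[OF c(1)] by (rule set_integral_norm_bound)
  moreover have "(LBINT t:{-T/2..T/2}. norm (f t - g t)) \<le> (LBINT t:{-T/2..T/2}. e)"
  proof (rule set_integral_mono)
    show "set_integrable lborel {-T/2..T/2} (\<lambda>t. norm (f t - g t))"
      using i[OF c(1)] by (rule set_integrable_norm)
    show "set_integrable lborel {-T/2..T/2} (\<lambda>t. e)"
      by (intro borel_integrable_atLeastAtMost' continuous_on_const)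
  qed (use le in auto)
  moreover have "(LBINT t:{-T/2..T/2}. e) = T * e"
    using T by (simp add: set_lebesgue_integral_def)
  ultimately show ?thesis
    using T by (simp add: divide_simps mult.commute)
qed

section \<open>Trigonometric polynomials have means\<close>

inductive trig_polynomial :: "(real \<Rightarrow> complex) \<Rightarrow> bool" where
  monomial: "trig_polynomial (\<lambda>t. c * cis (x * t))"
| add: "trig_polynomial f \<Longrightarrow> trig_polynomial g \<Longrightarrow> trig_polynomial (\<lambda>t. f t + g t)"

lemma trig_polynomial_const: "trig_polynomial (\<lambda>t. c)"
  using trig_polynomial.monomial[of c 0] by simp

lemma trig_polynomial_sum:
  assumes "\<And>j. j < N \<Longrightarrow> trig_polynomial (f j)"
  shows "trig_polynomial (\<lambda>t. \<Sum>j<(N::nat). f j t)"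
  using assms by (induction N) (auto intro: trig_polynomial_const trig_polynomial.add)

lemma trig_polynomial_mult:
  assumes "trig_polynomial f" "trig_polynomial g"
  shows "trig_polynomial (\<lambda>t. f t * g t)"
  using assms(1)
proof induction
  case (monomial c x)
  from assms(2) show ?case
  proof induction
    case (monomial d y)
    have "(\<lambda>t. c * cis (x * t) * (d * cis (y * t))) = (\<lambda>t. (c * d) * cis ((x + y) * t))"
      by (simp add: fun_eq_iff distrib_right cis_mult[symmetric])
    then show ?case by (simp only: trig_polynomial.monomial)
  qed (simp add: distrib_left trig_polynomial.add)
qed (simp add: distrib_right trig_polynomial.add)

lemma trig_polynomial_cnj: "trig_polynomial f \<Longrightarrow> trig_polynomial (\<lambda>t. cnj (f t))"
proof (induction rule: trig_polynomial.induct)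
  case (monomial c x)
  show ?case using trig_polynomial.monomial[of "cnj c" "-x"] by (simp add: cis_cnj)
qed (simp add: trig_polynomial.add)

lemma trig_polynomial_continuous: "trig_polynomial f \<Longrightarrow> continuous_on UNIV f"
  by (induction rule: trig_polynomial.induct) (auto intro!: continuous_intros)

text \<open>A non-constant exponential has a bounded primitive, so its mean is $O(1/T)$; the mean of a
  trigonometric polynomial is thus the coefficient of the frequency zero.\<close>

lemma trig_polynomial_mean_converges:
  "trig_polynomial f \<Longrightarrow> \<exists>L. ((\<lambda>T. mean T f) \<longlongrightarrow> L) at_top"
proof (induction rule: trig_polynomial.induct)
  case (monomial c x)
  show ?case
  proof (cases "x = 0")
    case True
    have "\<forall>\<^sub>F T in at_top. mean T (\<lambda>t. c * cis (x * t)) = c"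
      using eventually_gt_at_top[of "0::real"]
      by eventually_elim (simp add: True mean_def set_lebesgue_integral_def)
    then show ?thesis by (intro exI tendsto_eventually)
  next
    case False
    \<comment> \<open>a primitive of the exponential, of constant modulus\<close>
    define F where "F t = c * cis (x * t) / (\<i> * x)" for t
    have F': "(F has_vector_derivative c * cis (x * t)) (at t within S)" for t S
    proof -
      have "((\<lambda>z. c * exp (\<i> * (x * z)) / (\<i> * x)) has_field_derivative c * exp (\<i> * (x * t))) (at t)"
        using False by (auto intro!: derivative_eq_intros simp: mult_ac)
      from has_vector_derivative_real_field[OF this]
      show ?thesis by (simp add: F_def[abs_def] cis_conv_exp)
    qed
    have le: "norm (mean T (\<lambda>t. c * cis (x * t))) \<le> (2 * norm c / \<bar>x\<bar>) / T" if "T > 0" for T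
    proof -
      have int: "(LBINT t:{-T/2..T/2}. c * cis (x * t)) = F (T/2) - F (-T/2)"
        unfolding set_lebesgue_integral_def using that
        by (intro integral_FTC_Icc F') (auto intro!: continuous_intros)
      have "norm (F t) = norm c / \<bar>x\<bar>" for t
        by (simp add: F_def norm_mult norm_divide)
      then have "norm (F (T/2) - F (-T/2)) \<le> 2 * norm c / \<bar>x\<bar>"
        using norm_triangle_ineq4[of "F (T/2)" "F (-T/2)"] by simp
      then have "norm (F (T/2) - F (-T/2)) / T \<le> (2 * norm c / \<bar>x\<bar>) / T"
        using that by (intro divide_right_mono) simp_all
      then show ?thesis
        unfolding mean_def int using that by simp
    qed
    have "((\<lambda>T. (2 * norm c / \<bar>x\<bar>) / T) \<longlongrightarrow> 0) at_top"
      by (intro tendsto_divide_0[OF tendsto_const] filterlim_at_top_imp_at_infinity filterlim_ident)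
    then have "((\<lambda>T. mean T (\<lambda>t. c * cis (x * t))) \<longlongrightarrow> 0) at_top"
      by (intro Lim_null_comparison[OF eventually_mono[OF eventually_gt_at_top[of 0] le]])
    then show ?thesis ..
  qed
next
  case (add f g)
  have i: "set_integrable lborel {-T/2..T/2} h" if "trig_polynomial h" for h T
    using trig_polynomial_continuous[OF that]
    by (intro borel_integrable_atLeastAtMost') (auto intro: continuous_on_subset)
  have "mean T (\<lambda>t. f t + g t) = mean T f + mean T g" for T
    unfolding mean_def set_integral_add(2)[OF i[OF add.hyps(1)] i[OF add.hyps(2)]] scaleR_add_right ..
  then show ?case using add.IH by (auto intro: tendsto_add)
qed

lemma mean_of_real: "mean T (\<lambda>t. complex_of_real (h t)) = of_real (mean T h)"
  by (simp add: mean_def set_integral_complex_of_real scaleR_conv_of_real)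

lemma real_trig_polynomial_mean_converges:
  assumes "trig_polynomial (\<lambda>t. complex_of_real (h t))"
  shows "\<exists>L. ((\<lambda>T. mean T h) \<longlongrightarrow> L) at_top"
proof -
  obtain L where "((\<lambda>T. complex_of_real (mean T h)) \<longlongrightarrow> L) at_top"
    using trig_polynomial_mean_converges[OF assms] unfolding mean_of_real ..
  from tendsto_Re[OF this] show ?thesis by auto
qed

text \<open>For $T > 0$ the map from a function to its mean is a contraction for the supremum norm. Means of
  uniform approximations therefore converge uniformly in $T$, and the limits in $T$ and in the
  approximation parameter may be exchanged.\<close>

lemma mean_converges_uniform_limit:
  fixes g :: "real \<Rightarrow> real"
  assumes g: "continuous_on UNIV g"
    and approx: "\<And>e. e > 0 \<Longrightarrow> \<exists>h L. continuous_on UNIV h \<and> (\<forall>t. \<bar>g t - h t\<bar> \<le> e) \<and>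
      ((\<lambda>T. mean T h) \<longlongrightarrow> L) at_top"
  shows "\<exists>L. ((\<lambda>T. mean T g) \<longlongrightarrow> L) at_top"
proof -
  have "\<exists>h L. continuous_on UNIV h \<and> (\<forall>t. \<bar>g t - h t\<bar> \<le> inverse (real (Suc k))) \<and>
      ((\<lambda>T. mean T h) \<longlongrightarrow> L) at_top" for k
    by (intro approx) simp
  then obtain h L where h: "\<And>k. continuous_on UNIV (h k)"
      "\<And>k t. \<bar>g t - h k t\<bar> \<le> inverse (real (Suc k))" "\<And>k. ((\<lambda>T. mean T (h k)) \<longlongrightarrow> L k) at_top"
    by metis
  have close: "dist (mean T (h k)) (mean T g) \<le> inverse (real (Suc k))" if "T > 0" for T k
    using mean_diff_le[OF that h(1) g] h(2) by (simp add: dist_norm abs_minus_commute)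
  have unif: "uniform_limit {0<..} (\<lambda>k T. mean T (h k)) (\<lambda>T. mean T g) sequentially"
  proof (rule uniform_limitI)
    fix e :: real assume "e > 0"
    then have "\<forall>\<^sub>F k in sequentially. inverse (real (Suc k)) < e"
      using LIMSEQ_inverse_real_of_nat by (auto simp: order_tendsto_iff)
    then show "\<forall>\<^sub>F k in sequentially. \<forall>T\<in>{0<..}. dist (mean T (h k)) (mean T g) < e"
      by eventually_elim (auto intro: le_less_trans[OF close])
  qed
  have Ldiff: "dist (L k) (L l) \<le> inverse (real (Suc k)) + inverse (real (Suc l))" for k l
  proof (rule tendsto_upperbound[OF tendsto_dist[OF h(3) h(3)]])
    show "\<forall>\<^sub>F T in at_top. dist (mean T (h k)) (mean T (h l))
        \<le> inverse (real (Suc k)) + inverse (real (Suc l))"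
      using eventually_gt_at_top[of "0::real"]
    proof eventually_elim
      case (elim T)
      then show ?case
        using close[OF elim, of k] close[OF elim, of l]
          dist_triangle2[of "mean T (h k)" "mean T (h l)" "mean T g"] by linarith
    qed
  qed simp
  have "Cauchy L"
  proof (rule metric_CauchyI)
    fix e :: real assume "e > 0"
    then obtain M where M: "inverse (real (Suc M)) < e / 2"
      using reals_Archimedean[of "e / 2"] by auto
    show "\<exists>M. \<forall>k\<ge>M. \<forall>l\<ge>M. dist (L k) (L l) < e"
    proof (intro exI allI impI)
      fix k l assume "M \<le> k" "M \<le> l"
      then have "inverse (real (Suc k)) \<le> inverse (real (Suc M))"
          "inverse (real (Suc l)) \<le> inverse (real (Suc M))"
        by (auto intro!: le_imp_inverse_le)
      then show "dist (L k) (L l) < e" using Ldiff[of k l] M by linarith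
    qed
  qed
  then have "convergent L" by (rule Cauchy_convergent)
  then obtain l where "L \<longlonglongrightarrow> l" by (auto simp: convergent_def)
  then have "((\<lambda>T. mean T g) \<longlongrightarrow> l) at_top"
    by (rule swap_uniform_limit'[OF always_eventually[OF allI[OF h(3)]] _ unif])
       (simp_all add: eventually_gt_at_top)
  then show ?thesis ..
qed

text \<open>Approximating in the variable $|f|^2$ rather than $|f|$ matters: $|f|^2 = f \bar f$ is a
  trigonometric polynomial, while $|f|$ in general is not.\<close>

lemma mean_norm_trig_polynomial_converges:
  assumes f: "trig_polynomial f" and bdd: "\<And>t. norm (f t) \<le> S"
    and \<phi>: "continuous_on {0..} (\<phi> :: real \<Rightarrow> real)"
  shows "\<exists>L. ((\<lambda>T. mean T (\<lambda>t. \<phi> (norm (f t)))) \<longlongrightarrow> L) at_top"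
proof (rule mean_converges_uniform_limit)
  have cf: "continuous_on UNIV f" using f by (rule trig_polynomial_continuous)
  show "continuous_on UNIV (\<lambda>t. \<phi> (norm (f t)))"
    by (rule continuous_on_compose2[OF \<phi>]) (auto intro!: continuous_intros cf)
  fix e :: real assume "e > 0"
  have "continuous_on {0..S\<^sup>2} (\<lambda>x. \<phi> (sqrt x))"
    by (rule continuous_on_compose2[OF \<phi>]) (auto intro!: continuous_intros)
  from Stone_Weierstrass_real_polynomial_function[OF compact_Icc this \<open>e > 0\<close>]
  obtain r where r: "real_polynomial_function r"
      "\<And>x. x \<in> {0..S\<^sup>2} \<Longrightarrow> \<bar>\<phi> (sqrt x) - r x\<bar> < e" by blast
  have sq: "trig_polynomial (\<lambda>t. complex_of_real ((norm (f t))\<^sup>2))"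
    unfolding complex_norm_square by (intro trig_polynomial_mult trig_polynomial_cnj f)
  have tr: "trig_polynomial (\<lambda>t. complex_of_real (r ((norm (f t))\<^sup>2)))"
    using r(1)
  proof induction
    case (linear r)
    interpret bounded_linear r by fact
    have "r x = x * r 1" for x using scaleR[of x 1] by simp
    then have "(\<lambda>t. complex_of_real (r ((norm (f t))\<^sup>2)))
        = (\<lambda>t. complex_of_real ((norm (f t))\<^sup>2) * complex_of_real (r 1))"
      by (metis of_real_mult)
    then show ?case by (simp only: trig_polynomial_mult[OF sq trig_polynomial_const])
  qed (auto simp: trig_polynomial_const intro: trig_polynomial.add trig_polynomial_mult)
  have cont: "continuous_on UNIV (\<lambda>t. r ((norm (f t))\<^sup>2))"
    using continuous_on_Re[OF trig_polynomial_continuous[OF tr]] by simp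
  have close: "\<bar>\<phi> (norm (f t)) - r ((norm (f t))\<^sup>2)\<bar> \<le> e" for t
    using r(2)[of "(norm (f t))\<^sup>2"] bdd[of t] by (auto simp: power_mono)
  obtain L where L: "((\<lambda>T. mean T (\<lambda>t. r ((norm (f t))\<^sup>2))) \<longlongrightarrow> L) at_top"
    using real_trig_polynomial_mean_converges[OF tr] ..
  show "\<exists>h L. continuous_on UNIV h \<and> (\<forall>t. \<bar>\<phi> (norm (f t)) - h t\<bar> \<le> e) \<and>
      ((\<lambda>T. mean T h) \<longlongrightarrow> L) at_top"
    by (intro exI[of _ L] exI[of _ "\<lambda>t. r ((norm (f t))\<^sup>2)"] conjI allI cont close L)
qed

section \<open>Passing to integer frequencies\<close>

lemma mean_rescale:
  assumes "T > 0"
  shows "mean T (\<lambda>t. g (t / T)) = (LBINT s:{-1/2..1/2}. g s)"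
proof -
  have "(LBINT t:{-T/2..T/2}. g (t / T)) = T *\<^sub>R (LBINT s:{-1/2..1/2}. g s)"
  proof -
    have "indicator {-T/2..T/2} (T * s) = (indicator {-1/2..1/2} s :: real)" for s
    proof -
      have "- T / 2 \<le> T * s \<longleftrightarrow> -1/2 \<le> s" "T * s \<le> T / 2 \<longleftrightarrow> s \<le> 1/2"
        using mult_le_cancel_left_pos[OF assms, of "-1/2" s]
          mult_le_cancel_left_pos[OF assms, of s "1/2"] by simp_all
      then show ?thesis by (simp add: indicator_def)
    qed
    then show ?thesis
      unfolding set_lebesgue_integral_def using assms
      by (subst lborel_integral_real_affine[where c = T and t = 0]) simp_all
  qed
  then show ?thesis using assms by (simp add: mean_def)
qed

lemma norm_cis_diff_le: "norm (cis x - cis y) \<le> \<bar>x - y\<bar>"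
proof -
  have "cis x - cis y = cis y * (cis (x - y) - 1)"
    by (simp add: algebra_simps cis_mult)
  then have "norm (cis x - cis y) = norm (cis (x - y) - 1)"
    by (simp add: norm_mult)
  also have "\<dots> = 2 * \<bar>sin ((x - y) / 2)\<bar>"
    using dist_exp_i_1[of "x - y"] by (simp add: cis_conv_exp)
  also have "\<dots> \<le> \<bar>x - y\<bar>"
    using abs_sin_x_le_abs_x[of "(x - y) / 2"] by simp
  finally show ?thesis .
qed

text \<open>Dirichlet's theorem alone does not make the denominators large. Applying it to the multiples
  $(k+1) x_j$ and absorbing the factor $k+1$ into the denominator does.\<close>

lemma simultaneous_approximation:
  fixes x :: "nat \<Rightarrow> real"
  obtains m :: "nat \<Rightarrow> int" and n :: "nat \<Rightarrow> nat \<Rightarrow> int"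
  where "\<And>k. m k \<ge> int (Suc k)"
    and "\<And>k j. j < N \<Longrightarrow> \<bar>of_int (m k) * x j - of_int (n k j)\<bar> < 1 / real (Suc k)"
proof -
  have "\<exists>m n. m \<ge> int (Suc k) \<and>
      (\<forall>j<N. \<bar>of_int m * x j - of_int (n j)\<bar> < 1 / real (Suc k))" for k
  proof -
    obtain q p where q: "0 < q"
      and p: "\<And>j. j < N \<Longrightarrow> \<bar>of_int q * (real (Suc k) * x j) - of_int (p j)\<bar> < 1 / real (Suc k)"
      using Dirichlet_approx_simult[of "Suc k" N "\<lambda>j. real (Suc k) * x j"] by (metis zero_less_Suc)
    \<comment> \<open>the approximation denominator is \<open>q * (k + 1)\<close>\<close>
    have "int (Suc k) \<le> q * int (Suc k)" using q by simp
    then show ?thesis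
      using p by (intro exI[of _ "q * int (Suc k)"] exI[of _ p]) (simp add: mult.assoc)
  qed
  then show ?thesis using that by metis
qed

lemma frequency_perturbation_le:
  fixes x y :: "nat \<Rightarrow> real" and a :: "nat \<Rightarrow> complex"
  assumes "\<And>j. j < N \<Longrightarrow> \<bar>x j - y j\<bar> * \<bar>t\<bar> \<le> d"
  shows "norm ((\<Sum>j<N. a j * cis (2 * pi * x j * t)) - (\<Sum>j<N. a j * cis (2 * pi * y j * t)))
    \<le> 2 * pi * d * (\<Sum>j<N. norm (a j))"
proof -
  have "norm (a j * cis (2 * pi * x j * t) - a j * cis (2 * pi * y j * t)) \<le> 2 * pi * d * norm (a j)"
    if j: "j < N" for j
  proof -
    have "norm (cis (2 * pi * x j * t) - cis (2 * pi * y j * t))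
        \<le> \<bar>2 * pi * x j * t - 2 * pi * y j * t\<bar>"
      by (rule norm_cis_diff_le)
    also have "2 * pi * x j * t - 2 * pi * y j * t = 2 * pi * ((x j - y j) * t)"
      by (simp add: algebra_simps)
    also have "\<bar>\<dots>\<bar> = 2 * pi * (\<bar>x j - y j\<bar> * \<bar>t\<bar>)"
      by (simp add: abs_mult)
    also have "\<dots> \<le> 2 * pi * d"
      using assms[OF j] by (intro mult_left_mono) simp_all
    finally have "norm (a j) * norm (cis (2 * pi * x j * t) - cis (2 * pi * y j * t))
        \<le> norm (a j) * (2 * pi * d)"
      by (intro mult_left_mono) simp_all
    then show ?thesis
      by (simp add: norm_mult[symmetric] right_diff_distrib mult.commute)
  qed
  then show ?thesis
    unfolding sum_subtractf[symmetric] sum_distrib_left by (intro sum_norm_le) simp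
qed

text \<open>The frequencies $x_j$ are compared with $n_j/m$ on $[-m/2, m/2]$. That interval is exactly as
  long as a period of the approximating sum, and still short enough for the frequency error
  $o(1)/m$ to produce only a phase error $o(1)$. The continuous function $\varphi$ is uniformly
  continuous on the range of the sums, which are all bounded by $\sum_j |a_j|$.\<close>

proposition mean_as_limit_of_integer_frequencies:
  fixes x :: "nat \<Rightarrow> real" and a :: "nat \<Rightarrow> complex" and \<phi> :: "real \<Rightarrow> real"
  assumes \<phi>: "continuous_on {0..} \<phi>"
  obtains L :: real and m :: "nat \<Rightarrow> int" and n :: "nat \<Rightarrow> nat \<Rightarrow> int"
  where "((\<lambda>T. mean T (\<lambda>t. \<phi> (norm (\<Sum>j<N. a j * cis (2 * pi * x j * t))))) \<longlongrightarrow> L) at_top"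
    and "(\<lambda>k. LBINT t:{-1/2..1/2}. \<phi> (norm (\<Sum>j<N. a j * cis (2 * pi * of_int (n k j) * t)))) \<longlonglongrightarrow> L"
    and "\<And>k. m k > 0" and "\<And>j. j < N \<Longrightarrow> (\<lambda>k. of_int (n k j) / of_int (m k)) \<longlonglongrightarrow> x j"
proof -
  obtain m n where m: "\<And>k. m k \<ge> int (Suc k)"
    and n: "\<And>k j. j < N \<Longrightarrow> \<bar>of_int (m k) * x j - of_int (n k j)\<bar> < 1 / real (Suc k)"
    using simultaneous_approximation[of N x] by blast
  have m_pos: "m k > 0" for k using m[of k] by linarith
  have m_real: "real (Suc k) \<le> real_of_int (m k)" for k
    using m[of k] by (metis of_int_le_iff of_int_of_nat_eq)
  define y where "y k j = real_of_int (n k j) / real_of_int (m k)" for k j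
  have y: "\<bar>x j - y k j\<bar> \<le> inverse (real (Suc k)) / m k" if "j < N" for j k
  proof -
    have "x j - y k j = (m k * x j - n k j) / m k"
      using m_pos[of k] by (simp add: y_def diff_divide_distrib)
    then have "\<bar>x j - y k j\<bar> = \<bar>m k * x j - n k j\<bar> / m k"
      using m_pos[of k] by (simp add: abs_divide)
    also have "\<dots> \<le> inverse (real (Suc k)) / m k"
      using n[OF that, of k] m_pos[of k] by (intro divide_right_mono) (simp_all add: inverse_eq_divide)
    finally show ?thesis .
  qed
  define P where "P z t = (\<Sum>j<N. a j * cis (2 * pi * z j * t))" for z :: "nat \<Rightarrow> real" and t
  define S where "S = (\<Sum>j<N. norm (a j))"
  have P_bdd: "norm (P z t) \<le> S" for z t
    unfolding P_def S_def by (rule order_trans[OF norm_sum]) (simp add: norm_mult)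
  have P_trig: "trig_polynomial (P z)" for z
    unfolding P_def by (intro trig_polynomial_sum trig_polynomial.monomial)
  have P_cont: "continuous_on UNIV (\<lambda>t. \<phi> (norm (P z t)))" for z
    by (rule continuous_on_compose2[OF \<phi>])
       (auto intro!: continuous_on_norm trig_polynomial_continuous[OF P_trig])
  obtain L where L: "((\<lambda>T. mean T (\<lambda>t. \<phi> (norm (P x t)))) \<longlongrightarrow> L) at_top"
    using mean_norm_trig_polynomial_converges[OF P_trig P_bdd \<phi>] by blast
  have m_lim: "filterlim (\<lambda>k. real_of_int (m k)) at_top sequentially"
  proof (rule filterlim_at_top_mono[OF filterlim_real_sequentially always_eventually])
    show "\<forall>k. real k \<le> real_of_int (m k)"
      using m_real by (simp add: order_trans[OF _ m_real])
  qed
  have P_close: "norm (P x t - P (y k) t) \<le> pi * inverse (real (Suc k)) * S"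
    if t: "t \<in> {-real_of_int (m k)/2..m k/2}" for k t
  proof -
    have "\<bar>x j - y k j\<bar> * \<bar>t\<bar> \<le> inverse (real (Suc k)) / 2" if "j < N" for j
    proof -
      have "\<bar>t\<bar> \<le> m k / 2" using t by auto
      then have "\<bar>x j - y k j\<bar> * \<bar>t\<bar> \<le> (inverse (real (Suc k)) / m k) * (m k / 2)"
        by (rule mult_mono[OF y[OF that]]) (use m_pos[of k] in simp_all)
      then show ?thesis using m_pos[of k] by simp
    qed
    from frequency_perturbation_le[of N x "y k" t _ a, OF this]
    show ?thesis by (simp add: P_def S_def)
  qed
  have diff: "(\<lambda>k. mean (m k) (\<lambda>t. \<phi> (norm (P x t))) - mean (m k) (\<lambda>t. \<phi> (norm (P (y k) t)))) \<longlonglongrightarrow> 0"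
    (is "?D \<longlonglongrightarrow> 0")
  proof (rule tendstoI)
    fix r :: real assume r: "r > 0"
    have "uniformly_continuous_on {0..S} \<phi>"
      by (intro compact_uniformly_continuous compact_Icc continuous_on_subset[OF \<phi>]) auto
    then obtain d where d: "d > 0" "\<And>u v. u \<in> {0..S} \<Longrightarrow> v \<in> {0..S} \<Longrightarrow> dist u v < d \<Longrightarrow>
        dist (\<phi> u) (\<phi> v) < r / 2"
      using half_gt_zero[OF r] by (rule uniformly_continuous_onE) (metis dist_commute)
    have "(\<lambda>k. pi * inverse (real (Suc k)) * S) \<longlonglongrightarrow> pi * 0 * S"
      by (intro tendsto_mult tendsto_const LIMSEQ_inverse_real_of_nat)
    then have "\<forall>\<^sub>F k in sequentially. pi * inverse (real (Suc k)) * S < d"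
      by (rule order_tendstoD(2)) (use d(1) in simp)
    then show "\<forall>\<^sub>F k in sequentially. dist (?D k) 0 < r"
    proof eventually_elim
      case (elim k)
      have "norm (?D k) \<le> r / 2"
      proof (rule mean_diff_le)
        fix t assume t: "t \<in> {-real_of_int (m k)/2..m k/2}"
        have "dist (norm (P x t)) (norm (P (y k) t)) < d"
          using norm_triangle_ineq3[of "P x t" "P (y k) t"] P_close[OF t] elim
          by (simp add: dist_real_def)
        then have "dist (\<phi> (norm (P x t))) (\<phi> (norm (P (y k) t))) < r / 2"
          by (intro d(2)) (simp_all add: P_bdd)
        then show "norm (\<phi> (norm (P x t)) - \<phi> (norm (P (y k) t))) \<le> r / 2"
          by (simp add: dist_norm)
      qed (use m_pos in \<open>simp_all add: P_cont\<close>)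
      then show ?case using r by simp
    qed
  qed
  have "mean (m k) (\<lambda>t. \<phi> (norm (P (y k) t)))
      = (LBINT t:{-1/2..1/2}. \<phi> (norm (\<Sum>j<N. a j * cis (2 * pi * of_int (n k j) * t))))" for k
    using mean_rescale[of "m k" "\<lambda>t. \<phi> (norm (\<Sum>j<N. a j * cis (2 * pi * of_int (n k j) * t)))"] m_pos[of k]
    by (simp add: P_def y_def)
  then have "(\<lambda>k. LBINT t:{-1/2..1/2}. \<phi> (norm (\<Sum>j<N. a j * cis (2 * pi * of_int (n k j) * t)))) \<longlonglongrightarrow> L"
    using tendsto_diff[OF filterlim_compose[OF L m_lim] diff] by simp
  moreover have "(\<lambda>k. y k j) \<longlonglongrightarrow> x j" if j: "j < N" for j
  proof -
    have "norm (y k j - x j) \<le> inverse (real (Suc k))" for k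
    proof -
      have "norm (y k j - x j) \<le> inverse (real (Suc k)) / m k"
        using y[OF j, of k] by (simp add: abs_minus_commute)
      also have "\<dots> \<le> inverse (real (Suc k)) / 1"
        using m_real[of k] by (intro divide_left_mono) simp_all
      finally show ?thesis by simp
    qed
    then have "(\<lambda>k. y k j - x j) \<longlonglongrightarrow> 0"
      by (intro Lim_null_comparison[OF _ LIMSEQ_inverse_real_of_nat] always_eventually allI)
    then show ?thesis by (simp add: LIM_zero_iff)
  qed
  ultimately show ?thesis
    using that[of L n m] L m_pos unfolding P_def y_def by blast
qed

text \<open>Strict inequalities between the limits pass to the numerators because the denominator is common.
  The factor $c$ is $1$ when monotonicity is transferred, and a ratio slightly below the
  lacunarity ratio when lacunarity is.\<close>

lemma eventually_scaled_numerators_less: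
  fixes n :: "nat \<Rightarrow> nat \<Rightarrow> int" and m :: "nat \<Rightarrow> int" and x :: "nat \<Rightarrow> real"
  assumes m: "\<And>k. m k > 0"
    and lim: "\<And>j. j < N \<Longrightarrow> (\<lambda>k. of_int (n k j) / of_int (m k)) \<longlonglongrightarrow> x j"
    and less: "\<And>j. Suc j < N \<Longrightarrow> c * x j < x (Suc j)"
  shows "\<forall>\<^sub>F k in sequentially. \<forall>j. Suc j < N \<longrightarrow> c * of_int (n k j) < of_int (n k (Suc j))"
proof -
  have "\<forall>\<^sub>F k in sequentially. c * of_int (n k j) < of_int (n k (Suc j))" if j: "Suc j < N" for j
  proof -
    have "(\<lambda>k. of_int (n k (Suc j)) / of_int (m k) - c * (of_int (n k j) / of_int (m k)))
        \<longlonglongrightarrow> x (Suc j) - c * x j"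
      using j by (intro tendsto_intros lim) simp_all
    then have "\<forall>\<^sub>F k in sequentially. 0 < of_int (n k (Suc j)) / of_int (m k) - c * (of_int (n k j) / of_int (m k))"
      by (rule order_tendstoD(1)) (use less[OF j] in simp)
    then show ?thesis
    proof eventually_elim
      case (elim k)
      have "(of_int (n k (Suc j)) - c * of_int (n k j)) / real_of_int (m k) > 0"
        using elim by (simp add: diff_divide_distrib)
      then show ?case using m[of k] by (simp add: zero_less_divide_iff)
    qed
  qed
  moreover have "finite {j. Suc j < N}"
    by (rule finite_subset[of _ "{..<N}"]) auto
  ultimately have "\<forall>\<^sub>F k in sequentially. \<forall>j\<in>{j. Suc j < N}. c * of_int (n k j) < of_int (n k (Suc j))"
    by (intro eventually_ball_finite) simp_all
  then show ?thesis by simp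
qed

section \<open>The integer inequalities for finitely many frequencies\<close>

lemma MPS_inequality_initial_segment:
  assumes C: "MPS_constant C" and n: "\<And>j. Suc j < N \<Longrightarrow> n j < n (Suc j)"
  shows "C * (\<Sum>j<N. norm (a j) / (real j + 1))
    \<le> (LBINT t:{-1/2..1/2}. norm (\<Sum>j<N. a j * cis (2 * pi * of_int (n j) * t)))"
proof -
  have less: "n i < n j" if "i < j" "j < N" for i j
    using that
  proof (induction j)
    case (Suc j)
    then show ?case using n[of j] by (cases "i = j") auto
  qed simp
  have "strict_mono_on {1..N} (\<lambda>k. n (k - 1))"
    by (rule strict_mono_onI) (auto intro!: less)
  then have "C * (\<Sum>k=1..N. norm (a (k - 1)) / real k)
      \<le> (LBINT t:{-1/2..1/2}. norm (\<Sum>k=1..N. a (k - 1) * cis (2 * pi * of_int (n (k - 1)) * t)))"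
    by (rule C[unfolded MPS_constant_def, THEN conjunct2, rule_format])
  then show ?thesis by (simp add: sum.atLeast1_atMost_eq add.commute)
qed

text \<open>Two adjustments bring a finite sum over $[-1/2, 1/2]$ into the form of the integer inequality. The
  finite list of frequencies is continued to an infinite lacunary one by a geometric progression, with coefficients
  zero. The interval is moved to $[0, 1]$ by a translation of $1/2$, which multiplies each coefficient by a
  number of modulus one and so leaves the $\ell^2$ norm unchanged.\<close>

lemma lacunary_inequality_initial_segment:
  fixes n :: "nat \<Rightarrow> int" and a :: "nat \<Rightarrow> complex"
  assumes AB: "lacunary_constants A B" and p: "p \<ge> 1" and q: "q > 1" and N: "N > 0"
    and n0: "n 0 \<ge> 1" and n: "\<And>j. Suc j < N \<Longrightarrow> q * of_int (n j) \<le> of_int (n (Suc j))"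
  defines "I \<equiv> LBINT t:{-1/2..1/2}. norm (\<Sum>j<N. a j * cis (2 * pi * of_int (n j) * t)) powr p"
    and "S \<equiv> sqrt (\<Sum>j<N. (norm (a j))\<^sup>2)"
  shows "A p q * S \<le> I powr (1 / p)" and "I powr (1 / p) \<le> B p q * S"
proof -
  \<comment> \<open>the two branches agree at \<open>j = N - 1\<close>, so the step across the seam is a geometric step as well\<close>
  define n' where "n' j = (if j < N then n j else n (N - 1) * \<lceil>q\<rceil> ^ (j - (N - 1)))" for j
  \<comment> \<open>the factor is the value at \<open>-1/2\<close> of the exponential with frequency \<open>n j\<close>\<close>
  define c where "c j = (if j < N then a j * cis (- (pi * of_int (n j))) else 0)" for j
  define F where "F t = (\<Sum>j<N. c j * cis (2 * pi * of_int (n' j) * t))" for t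
  define P where "P t = (\<Sum>j<N. a j * cis (2 * pi * of_int (n j) * t))" for t
  have n_pos: "n j \<ge> 1" if "j < N" for j
    using that
  proof (induction j)
    case (Suc j)
    then have "1 \<le> real_of_int (n j)" by simp
    then have "1 * 1 \<le> q * real_of_int (n j)" using q by (intro mult_mono) simp_all
    also have "\<dots> \<le> of_int (n (Suc j))" by (rule n) fact
    finally show ?case by simp
  qed (rule n0)
  have lac: "lacunary q (\<lambda>j. of_int (n' j))"
    unfolding lacunary_def
  proof (intro conjI allI)
    show "1 \<le> real_of_int (n' 0)" using N n0 by (simp add: n'_def)
    fix j
    show "q * real_of_int (n' j) \<le> real_of_int (n' (Suc j))"
    proof (cases "Suc j < N")
      case True
      then show ?thesis using n[OF True] by (simp add: n'_def)
    next
      case False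
      then have eq: "n' i = n (N - 1) * \<lceil>q\<rceil> ^ (i - (N - 1))" if "i = j \<or> i = Suc j" for i
        using that N by (auto simp: n'_def intro!: arg_cong[where f = n])
      have "n' (Suc j) = n' j * \<lceil>q\<rceil>"
        using False N by (simp add: eq Suc_diff_le)
      moreover have "0 \<le> n' j"
        using n_pos[of "N - 1"] N q by (simp add: eq)
      ultimately show ?thesis
        using mult_left_mono[OF le_of_int_ceiling[of q], of "real_of_int (n' j)"]
        by (simp add: mult.commute)
    qed
  qed
  have norm_c: "norm (c j) = (if j < N then norm (a j) else 0)" for j
    by (simp add: c_def norm_mult)
  have c_sums: "(\<lambda>j. (norm (c j))\<^sup>2) sums (\<Sum>j<N. (norm (a j))\<^sup>2)"
  proof -
    have "(\<lambda>j. (norm (c j))\<^sup>2) sums (\<Sum>j<N. (norm (c j))\<^sup>2)"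
      by (rule sums_finite) (auto simp: norm_c)
    then show ?thesis by (simp add: norm_c)
  qed
  have F_sum: "L2_trig_sum n' c F"
    unfolding L2_trig_sum_def
  proof
    have "continuous_on UNIV F"
      unfolding F_def by (intro continuous_intros)
    then show "F \<in> borel_measurable lborel"
      by (simp add: borel_measurable_continuous_onI)
    have "F t = (\<Sum>j<M. c j * cis (2 * pi * of_int (n' j) * t))" if "M \<ge> N" for M t
      unfolding F_def using that by (intro sum.mono_neutral_left) (auto simp: c_def)
    then have "\<forall>\<^sub>F M in sequentially. (\<integral>\<^sup>+t\<in>{0..1}. ennreal ((norm (F t -
        (\<Sum>j<M. c j * cis (2 * pi * of_int (n' j) * t))))\<^sup>2) \<partial>lborel) = 0"
      unfolding eventually_sequentially by (intro exI[of _ N]) simp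
    then show "(\<lambda>M. \<integral>\<^sup>+t\<in>{0..1}. ennreal ((norm (F t -
        (\<Sum>j<M. c j * cis (2 * pi * of_int (n' j) * t))))\<^sup>2) \<partial>lborel) \<longlonglongrightarrow> 0"
      by (rule tendsto_eventually)
  qed
  have F_eq: "F t = P (t - 1/2)" for t
    unfolding F_def P_def
  proof (intro sum.cong refl)
    fix j assume "j \<in> {..<N}"
    then have "c j * cis (2 * pi * of_int (n' j) * t)
        = a j * (cis (- (pi * of_int (n j))) * cis (2 * pi * of_int (n j) * t))"
      by (simp add: c_def n'_def)
    also have "\<dots> = a j * cis (2 * pi * of_int (n j) * (t - 1/2))"
      unfolding cis_mult by (simp add: algebra_simps)
    finally show "c j * cis (2 * pi * of_int (n' j) * t) = a j * cis (2 * pi * of_int (n j) * (t - 1/2))" .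
  qed
  have "I = (LBINT t:{0..1}. norm (F t) powr p)"
  proof -
    have "indicator {-1/2..1/2} (t - 1/2) = (indicator {0..1} t :: real)" for t :: real
      by (auto simp: indicator_def)
    then show ?thesis
      unfolding I_def P_def[symmetric] F_eq set_lebesgue_integral_def
      by (subst lborel_integral_real_affine[where c = 1 and t = "-1/2"]) (simp_all add: algebra_simps)
  qed
  moreover have "S = sqrt (\<Sum>j. (norm (c j))\<^sup>2)"
    using sums_unique[OF c_sums] by (simp add: S_def)
  ultimately show "A p q * S \<le> I powr (1 / p)" and "I powr (1 / p) \<le> B p q * S"
    using AB p q lac F_sum sums_summable[OF c_sums] unfolding lacunary_constants_def by auto
qed

section \<open>The inequalities for real frequencies\<close>

theorem MPS_inequality_mean:
  fixes x :: "nat \<Rightarrow> real" and a :: "nat \<Rightarrow> complex"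
  assumes C: "MPS_constant C" and incr: "\<And>j. Suc j < N \<Longrightarrow> x j < x (Suc j)"
  shows "\<exists>L. ((\<lambda>T. mean T (\<lambda>t. norm (\<Sum>j<N. a j * cis (2 * pi * x j * t)))) \<longlongrightarrow> L) at_top \<and>
    C * (\<Sum>j<N. norm (a j) / (real j + 1)) \<le> L"
proof -
  obtain L m n where L: "((\<lambda>T. mean T (\<lambda>t. norm (\<Sum>j<N. a j * cis (2 * pi * x j * t)))) \<longlongrightarrow> L) at_top"
    and I: "(\<lambda>k. LBINT t:{-1/2..1/2}. norm (\<Sum>j<N. a j * cis (2 * pi * of_int (n k j) * t))) \<longlonglongrightarrow> L"
    and m: "\<And>k. m k > (0::int)" and n: "\<And>j. j < N \<Longrightarrow> (\<lambda>k. of_int (n k j) / of_int (m k)) \<longlonglongrightarrow> x j"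
    by (rule mean_as_limit_of_integer_frequencies[OF continuous_on_id, where N = N and a = a and x = x]) blast
  have "\<forall>\<^sub>F k in sequentially. \<forall>j. Suc j < N \<longrightarrow> 1 * real_of_int (n k j) < of_int (n k (Suc j))"
    using incr by (intro eventually_scaled_numerators_less[OF m n]) simp_all
  then have "\<forall>\<^sub>F k in sequentially. C * (\<Sum>j<N. norm (a j) / (real j + 1))
      \<le> (LBINT t:{-1/2..1/2}. norm (\<Sum>j<N. a j * cis (2 * pi * of_int (n k j) * t)))"
    by eventually_elim (intro MPS_inequality_initial_segment[OF C], simp)
  then have "C * (\<Sum>j<N. norm (a j) / (real j + 1)) \<le> L"
    by (intro tendsto_lowerbound[OF I]) simp_all
  with L show ?thesis by blast
qed

text \<open>The approximating integers are lacunary with any ratio $r < q$, so the bounds hold first with the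
  constants at $r$; continuity at $q$ from the left gives them at $q$.\<close>

theorem lacunary_inequality_mean:
  fixes x :: "nat \<Rightarrow> real" and a :: "nat \<Rightarrow> complex"
  assumes AB: "lacunary_constants A B" and p: "p \<ge> 1" and q: "q > 1" and N: "N > 0"
    and lac: "lacunary q x"
  defines "S \<equiv> sqrt (\<Sum>j<N. (norm (a j))\<^sup>2)"
  shows "\<exists>L. ((\<lambda>T. mean T (\<lambda>t. norm (\<Sum>j<N. a j * cis (2 * pi * x j * t)) powr p) powr (1 / p)) \<longlongrightarrow> L) at_top \<and>
    A p q * S \<le> L \<and> L \<le> B p q * S"
proof -
  have "continuous_on {0..} (\<lambda>x::real. x powr p)"
    by (intro continuous_on_powr' continuous_on_id continuous_on_const) (use p in auto)
  then obtain L m n where L: "((\<lambda>T. mean T (\<lambda>t. norm (\<Sum>j<N. a j * cis (2 * pi * x j * t)) powr p)) \<longlongrightarrow> L) at_top"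
    and I: "(\<lambda>k. LBINT t:{-1/2..1/2}. norm (\<Sum>j<N. a j * cis (2 * pi * of_int (n k j) * t)) powr p) \<longlonglongrightarrow> L"
    and m: "\<And>k. m k > (0::int)" and n: "\<And>j. j < N \<Longrightarrow> (\<lambda>k. of_int (n k j) / of_int (m k)) \<longlonglongrightarrow> x j"
    by (rule mean_as_limit_of_integer_frequencies[where N = N and a = a and x = x]) blast
  have nonneg: "(LBINT t:X. norm (g t) powr p) \<ge> 0" for X and g :: "real \<Rightarrow> complex"
    unfolding set_lebesgue_integral_def by (intro Bochner_Integration.integral_nonneg) simp
  have I_root: "(\<lambda>k. (LBINT t:{-1/2..1/2}. norm (\<Sum>j<N. a j * cis (2 * pi * of_int (n k j) * t)) powr p) powr (1 / p))
      \<longlonglongrightarrow> L powr (1 / p)"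
    using p by (intro tendsto_powr'[OF I tendsto_const]) (simp add: nonneg)
  have L_root: "((\<lambda>T. mean T (\<lambda>t. norm (\<Sum>j<N. a j * cis (2 * pi * x j * t)) powr p) powr (1 / p))
      \<longlongrightarrow> L powr (1 / p)) at_top"
  proof (intro tendsto_powr'[OF L tendsto_const] disjI2 conjI)
    show "\<forall>\<^sub>F T in at_top. 0 \<le> mean T (\<lambda>t. norm (\<Sum>j<N. a j * cis (2 * pi * x j * t)) powr p)"
      using eventually_gt_at_top[of "0::real"]
      by eventually_elim (simp add: mean_def nonneg)
  qed (use p in simp)
  have x_ge: "x j \<ge> 1" for j
  proof (induction j)
    case (Suc j)
    then have "1 * 1 \<le> q * x j" using q by (intro mult_mono) simp_all
    also have "\<dots> \<le> x (Suc j)" using lac by (simp add: lacunary_def)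
    finally show ?case by simp
  qed (use lac in \<open>simp add: lacunary_def\<close>)
  have bounds: "A p r * S \<le> L powr (1 / p) \<and> L powr (1 / p) \<le> B p r * S" if r: "r \<in> {1<..<q}" for r
  proof -
    have "r * x j < x (Suc j)" for j
    proof -
      have "r * x j < q * x j" using r x_ge[of j] by (intro mult_strict_right_mono) auto
      also have "\<dots> \<le> x (Suc j)" using lac by (simp add: lacunary_def)
      finally show ?thesis .
    qed
    then have "\<forall>\<^sub>F k in sequentially. \<forall>j. Suc j < N \<longrightarrow> r * real_of_int (n k j) < of_int (n k (Suc j))"
      by (intro eventually_scaled_numerators_less[OF m n])
    moreover have "\<forall>\<^sub>F k in sequentially. 0 < real_of_int (n k 0) / of_int (m k)"
      using x_ge[of 0] by (intro order_tendstoD(1)[OF n[OF N]]) linarith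
    ultimately have ev: "\<forall>\<^sub>F k in sequentially.
        n k 0 \<ge> 1 \<and> (\<forall>j. Suc j < N \<longrightarrow> r * real_of_int (n k j) \<le> of_int (n k (Suc j)))"
    proof eventually_elim
      case (elim k)
      then have "0 < n k 0" using m[of k] by (simp add: zero_less_divide_iff)
      then show ?case using elim(1) by (auto intro: less_imp_le)
    qed
    from r have r1: "r > 1" by simp
    let ?I = "\<lambda>k. (LBINT t:{-1/2..1/2}. norm (\<Sum>j<N. a j * cis (2 * pi * of_int (n k j) * t)) powr p) powr (1 / p)"
    have "\<forall>\<^sub>F k in sequentially. A p r * S \<le> ?I k \<and> ?I k \<le> B p r * S"
      using ev unfolding S_def
      by eventually_elim (intro conjI lacunary_inequality_initial_segment[OF AB p r1 N], simp_all)
    then show ?thesis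
      by (intro conjI tendsto_lowerbound[OF I_root] tendsto_upperbound[OF I_root])
         (simp_all add: eventually_conj_iff)
  qed
  have near: "\<forall>\<^sub>F r in at_left q. r \<in> {1<..<q}"
    by (rule eventually_at_left_real[OF q])
  have left: "((\<lambda>r. f r * S) \<longlongrightarrow> f q * S) (at_left q)" if "continuous_on {1<..} f" for f :: "real \<Rightarrow> real"
  proof -
    have "isCont f q"
      using that q by (simp add: continuous_on_eq_continuous_at)
    then have "(f \<longlongrightarrow> f q) (at_left q)"
      unfolding isCont_def by (rule tendsto_mono[rotated]) (simp add: at_le)
    then show ?thesis by (rule tendsto_mult_right)
  qed
  have cont: "continuous_on {1<..} (A p)" "continuous_on {1<..} (B p)"
    using AB p by (auto simp: lacunary_constants_def)
  have "A p q * S \<le> L powr (1 / p)"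
    by (rule tendsto_upperbound[OF left[OF cont(1)] eventually_mono[OF near]]) (use bounds in auto)
  moreover have "L powr (1 / p) \<le> B p q * S"
    by (rule tendsto_lowerbound[OF left[OF cont(2)] eventually_mono[OF near]]) (use bounds in auto)
  ultimately show ?thesis using L_root by blast
qed

theorem theorem4p1:
  fixes lam :: "nat \<Rightarrow> real" and a :: "nat \<Rightarrow> complex"
    and C :: real and A B :: "real \<Rightarrow> real \<Rightarrow> real"
  assumes incr: "\<forall>j. lam (Suc j) - lam j > 0"
    and supp: "finite {j. a j \<noteq> 0}"
  shows "(MPS_constant C \<longrightarrow>
      (\<exists>L. ((\<lambda>T. 1 / T * (LBINT t:{-T/2..T/2}. norm (\<Sum>j. a j * cis (2 * pi * lam j * t))))
              \<longlongrightarrow> L) at_top \<and>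
           L \<ge> C * (\<Sum>j. norm (a j) / (real j + 1)))) \<and>
    (lacunary_constants A B \<longrightarrow>
      (\<forall>q>1. lacunary q lam \<longrightarrow> (\<forall>p\<ge>1.
        \<exists>L. ((\<lambda>T. (1 / T * (LBINT t:{-T/2..T/2}. norm (\<Sum>j. a j * cis (2 * pi * lam j * t)) powr p)) powr (1 / p))
              \<longlongrightarrow> L) at_top \<and>
           A p q * sqrt (\<Sum>j. (norm (a j))\<^sup>2) \<le> L \<and>
           L \<le> B p q * sqrt (\<Sum>j. (norm (a j))\<^sup>2))))"
proof -
  obtain M where "\<forall>j\<in>{j. a j \<noteq> 0}. j < M"
    using supp finite_nat_set_iff_bounded by metis
  then obtain N where N: "N > 0" and a0: "\<And>j. j \<notin> {..<N} \<Longrightarrow> a j = 0"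
    using that[of "Suc M"] by force
  have series: "(\<Sum>j. a j * cis (2 * pi * lam j * t)) = (\<Sum>j<N. a j * cis (2 * pi * lam j * t))" for t
    by (rule suminf_finite) (simp_all add: a0)
  have weighted: "(\<Sum>j. norm (a j) / (real j + 1)) = (\<Sum>j<N. norm (a j) / (real j + 1))"
    by (rule suminf_finite) (simp_all add: a0)
  have squares: "(\<Sum>j. (norm (a j))\<^sup>2) = (\<Sum>j<N. (norm (a j))\<^sup>2)"
    by (rule suminf_finite) (simp_all add: a0)
  show ?thesis
    unfolding series weighted squares
  proof (intro conjI impI allI)
    assume "MPS_constant C"
    then show "\<exists>L. ((\<lambda>T. 1 / T * (LBINT t:{-T/2..T/2}. norm (\<Sum>j<N. a j * cis (2 * pi * lam j * t))))
        \<longlongrightarrow> L) at_top \<and> C * (\<Sum>j<N. norm (a j) / (real j + 1)) \<le> L"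
      by (rule MPS_inequality_mean[unfolded mean_def real_scaleR_def]) (use incr in simp)
  next
    fix q p :: real
    assume "lacunary_constants A B" "q > 1" "lacunary q lam" "p \<ge> 1"
    then show "\<exists>L. ((\<lambda>T. (1 / T * (LBINT t:{-T/2..T/2}.
        norm (\<Sum>j<N. a j * cis (2 * pi * lam j * t)) powr p)) powr (1 / p)) \<longlongrightarrow> L) at_top \<and>
        A p q * sqrt (\<Sum>j<N. (norm (a j))\<^sup>2) \<le> L \<and> L \<le> B p q * sqrt (\<Sum>j<N. (norm (a j))\<^sup>2)"
      by (intro lacunary_inequality_mean[unfolded mean_def real_scaleR_def] N)
  qed
qed

end
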